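(* Let $(d_n)_{n\in\mathbb N_0}$ be a sequence of nonnegative integers such that $d_0=1$ and $$\left\lceil \sqrt[m+1]{d_{m+1}}\,\right\rceil\le\left\lfloor\sqrt[m]{d_m}\right\rfloor$$ for all $m\ge 1$. Then there exists a word system $(X_n)_{n\in\mathbb N_0}$ (over some alphabet) with $\#X_n=d_n$ for all $n\in\mathbb N=\{1,2,\dots\}$.
   Context: For $a\in\mathbb R$, $\lceil a\rceil=\min\{n\in\mathbb Z\mid n\ge a\}$ and $\lfloor a\rfloor=\max\{n\in\mathbb Z\mid n\le a\}$. An alphabet is a set $A$. $A^n$ is the set of words of length $n$ over $A$ ($n$-tuples), $A^0=\{\Lambda\}$ with $\Lambda=()$ the empty word, and $A^*=\bigcup_{n\in\mathbb N_0}A^n$ is a monoid under concatenation. A word $y$ is a subword of $w$ if $w=xyz$ for some $x,z\in A^*$. A word system over $A$ is a family $(X_n)_{n\in\mathbb N_0}$ of subsets $X_n\subset A^n$ with $X_0=A^0$ such that whenever $w\in\bigcup_n X_n$ and $y\in A^k$ is a subword of $w$, then $y\in X_k$. *)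

theory Defs
  imports Complex_Main "HOL-Library.Sublist" "HOL-Library.NList"
begin

text \<open>
  Words are lists: \<open>nlists n A\<close> is the set \<open>A\<^sup>n\<close> of words of length \<open>n\<close> over \<open>A\<close>, and
  \<open>sublist y w\<close> states that \<open>w = x @ y @ z\<close> for some \<open>x\<close>, \<open>z\<close> (a contiguous factor). If \<open>w\<close> is a
  word over \<open>A\<close>, then so are \<open>x\<close> and \<open>z\<close>.
\<close>

definition word_system :: "'a set \<Rightarrow> (nat \<Rightarrow> 'a list set) \<Rightarrow> bool" where
  "word_system A X \<longleftrightarrow>
     (\<forall>n. X n \<subseteq> nlists n A) \<and>
     X 0 = nlists 0 A \<and>
     (\<forall>w \<in> (\<Union>n. X n). \<forall>k. \<forall>y \<in> nlists k A. sublist y w \<longrightarrow> y \<in> X k)"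

end

theory Submission
  imports Defs
begin

text \<open>
  Let \<open>b\<^sub>n = \<lceil>root (n + 1) d\<^sub>n\<^sub>+\<^sub>1\<rceil>\<close>. The hypothesis makes \<open>b\<close> nonincreasing and gives
  \<open>b\<^sub>n\<^sup>n \<le> d\<^sub>n \<le> b\<^sub>n\<^sub>-\<^sub>1\<^sup>n\<close> for \<open>n \<ge> 1\<close>. Hence \<open>X\<^sub>n\<close> can be chosen of size \<open>d\<^sub>n\<close> between the
  words of length \<open>n\<close> over \<open>{0,\<dots>,b\<^sub>n - 1}\<close> and those over \<open>{0,\<dots>,b\<^sub>n\<^sub>-\<^sub>1 - 1}\<close>. A proper
  subword, of length \<open>k < n\<close>, of a word in \<open>X\<^sub>n\<close> only uses letters below \<open>b\<^sub>n\<^sub>-\<^sub>1 \<le> b\<^sub>k\<close>, so it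
  lies in \<open>X\<^sub>k\<close>.
\<close>

lemma finite_nlists: "finite A \<Longrightarrow> finite (nlists n A)"
  using finite_lists_length_eq[of A n] by (simp only: nlists_def conj_commute)

lemma card_nlists: "finite A \<Longrightarrow> card (nlists n A) = card A ^ n"
  using card_lists_length_eq[of A n] by (simp only: nlists_def conj_commute)

lemma nlists_sublist:
  assumes "w \<in> nlists n A" "sublist y w"
  shows "y \<in> nlists (length y) A"
  using assms set_mono_sublist[of y w] nlistsE_set[of w n A] by (blast intro: nlistsI)

lemma sublist_same_length:
  assumes "sublist y w" "length y = length w"
  shows "y = w"
  using assms by (auto simp: sublist_def)

lemma word_systemI:
  assumes words: "\<And>n. X n \<subseteq> nlists n A"
    and empty_word: "[] \<in> X 0"
    and sublists: "\<And>n w y. w \<in> X n \<Longrightarrow> sublist y w \<Longrightarrow> y \<in> X (length y)"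
  shows "word_system A X"
  unfolding word_system_def
proof (intro conjI ballI allI impI)
  show "X n \<subseteq> nlists n A" for n
    by (rule words)
  show "X 0 = nlists 0 A"
    using words[of 0] empty_word by auto
  show "y \<in> X k" if "w \<in> (\<Union>n. X n)" "y \<in> nlists k A" "sublist y w" for w k y
    using that sublists nlistsE_length[OF that(2)] by blast
qed

text \<open>At \<open>n = 0\<close> the truncated \<open>n - 1\<close> is harmless: only the empty word has length \<open>0\<close>.\<close>

lemma word_system_between:
  fixes B :: "nat \<Rightarrow> 'a set"
  assumes "decseq B"
    and lower: "\<And>n. nlists n (B n) \<subseteq> X n"
    and upper: "\<And>n. X n \<subseteq> nlists n (B (n - 1))"
  shows "word_system (B 0) X"
proof (rule word_systemI)
  show words: "X n \<subseteq> nlists n (B 0)" for n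
    using upper nlists_mono[OF decseqD[OF \<open>decseq B\<close>]] by blast
  show "[] \<in> X 0"
    using lower[of 0] by simp
  show "y \<in> X (length y)" if w: "w \<in> X n" and y: "sublist y w" for n w y
  proof -
    have length_w: "length w = n"
      using w words by (blast intro: nlistsE_length)
    show ?thesis
    proof (cases "length y = n")
      case True
      then show ?thesis
        using sublist_same_length[OF y] length_w w by simp
    next
      case False
      then have "length y \<le> n - 1"
        using sublist_length_le[OF y] length_w by simp
      have "y \<in> nlists (length y) (B (n - 1))"
        using w upper y by (blast intro: nlists_sublist)
      also have "\<dots> \<subseteq> nlists (length y) (B (length y))"
        using nlists_mono[OF decseqD[OF \<open>decseq B\<close> \<open>length y \<le> n - 1\<close>]] .
      also have "\<dots> \<subseteq> X (length y)"
        by (rule lower)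
      finally show ?thesis .
    qed
  qed
qed

lemma exists_word_system_with_card:
  fixes B :: "nat \<Rightarrow> 'a set"
  assumes "decseq B" "finite (B 0)"
    and lower: "\<And>n. card (B n) ^ n \<le> d n"
    and upper: "\<And>n. d n \<le> card (B (n - 1)) ^ n"
  shows "\<exists>X. word_system (B 0) X \<and> (\<forall>n. finite (X n) \<and> card (X n) = d n)"
proof -
  have finite_B: "finite (B n)" for n
    using finite_subset[OF decseqD[OF \<open>decseq B\<close>] \<open>finite (B 0)\<close>] by simp
  have "\<exists>Y. nlists n (B n) \<subseteq> Y \<and> Y \<subseteq> nlists n (B (n - 1)) \<and> card Y = d n" for n
    using exists_subset_between[of "nlists n (B n)" "d n" "nlists n (B (n - 1))"] lower upper
    by (simp add: card_nlists finite_nlists finite_B nlists_mono decseqD[OF \<open>decseq B\<close>])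
  then obtain X where X: "\<And>n. nlists n (B n) \<subseteq> X n" "\<And>n. X n \<subseteq> nlists n (B (n - 1))"
    "\<And>n. card (X n) = d n"
    by metis
  have "finite (X n)" for n
    using finite_subset[OF X(2) finite_nlists[OF finite_B]] .
  then show ?thesis
    using word_system_between[OF \<open>decseq B\<close> X(1,2)] X(3) by blast
qed

lemma le_nat_floor_root_iff:
  assumes "0 < n" "0 \<le> x"
  shows "k \<le> nat \<lfloor>root n x\<rfloor> \<longleftrightarrow> real k ^ n \<le> x"
proof -
  have "k \<le> nat \<lfloor>root n x\<rfloor> \<longleftrightarrow> real k \<le> root n x"
    using assms by (simp add: le_nat_iff le_floor_iff)
  also have "\<dots> \<longleftrightarrow> root n (real k ^ n) \<le> root n x"
    using assms by (simp add: real_root_power_cancel)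
  finally show ?thesis
    using assms by (simp only: real_root_le_iff)
qed

lemma nat_ceiling_root_le_iff:
  assumes "0 < n"
  shows "nat \<lceil>root n x\<rceil> \<le> k \<longleftrightarrow> x \<le> real k ^ n"
proof -
  have "nat \<lceil>root n x\<rceil> \<le> k \<longleftrightarrow> root n x \<le> root n (real k ^ n)"
    using assms by (simp add: real_root_power_cancel)
  then show ?thesis
    using assms by (simp only: real_root_le_iff)
qed

theorem theorem5p7:
  fixes d :: "nat \<Rightarrow> nat"
  assumes "d 0 = 1"
    and "\<And>m. m \<ge> 1 \<Longrightarrow>
      \<lceil>root (m + 1) (real (d (m + 1)))\<rceil> \<le> \<lfloor>root m (real (d m))\<rfloor>"
  shows "\<exists>(A :: nat set) X. word_system A X \<and>
    (\<forall>n\<ge>1. finite (X n) \<and> card (X n) = d n)"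
proof -
  define b where "b n = nat \<lceil>root (Suc n) (real (d (Suc n)))\<rceil>" for n
  have b_le_floor: "b n \<le> nat \<lfloor>root n (real (d n))\<rfloor>" if "n \<ge> 1" for n
    using nat_mono[OF assms(2)[OF that]] by (simp only: b_def Suc_eq_plus1)
  have "b (Suc n) \<le> b n" for n
    using b_le_floor[of "Suc n"] nat_mono[OF floor_le_ceiling] unfolding b_def
    by (rule order_trans) simp
  then have "decseq (\<lambda>n. {..<b n})"
    by (simp add: decseq_SucI)
  moreover have "b n ^ n \<le> d n" for n
    using b_le_floor[of n] le_nat_floor_root_iff[of n "real (d n)" "b n", folded of_nat_power]
      assms(1)
    by (cases "n = 0") (simp_all del: of_nat_power)
  moreover have "d n \<le> b (n - 1) ^ n" for n
    using nat_ceiling_root_le_iff[of n "real (d n)" "b (n - 1)", folded of_nat_power] assms(1)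
    by (cases n) (simp_all add: b_def del: power_Suc of_nat_power of_nat_nat)
  ultimately have "\<exists>X. word_system {..<b 0} X \<and> (\<forall>n. finite (X n) \<and> card (X n) = d n)"
    by (intro exists_word_system_with_card) simp_all
  then show ?thesis
    by blast
qed

end
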